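(* Let $p\ge 2$ and $n\ge 2$ be integers, let $E\in\mathbb{Z}[X]$ be a monic polynomial of degree $n$, and let $\gamma$ be an integer with $0<\gamma<p$ and $E(\gamma)\equiv 0\pmod p$. Let $\mathfrak{L}\subseteq\mathbb{Z}^n$ be the lattice generated by the rows $A_0=(p,0,\dots,0)$ and $A_i=-\gamma e_{i-1}+e_i$ for $1\le i\le n-1$ (where $e_0,\dots,e_{n-1}$ is the standard basis of $\mathbb{Z}^n$), and let $r$ be the covering radius of $\mathfrak{L}$ with respect to the Euclidean norm, i.e. the smallest $r\ge 0$ such that for every $T\in\mathbb{R}^n$ there is $V\in\mathfrak{L}$ with $\|T-V\|_2\le r$. If $\rho>r$, then $(p,n,\gamma,\rho)_E$ is a Polynomial Modular Number System.
   Context: A Polynomial Modular Number System (PMNS) $(p,n,\gamma,\rho)_E$ consists of integers $p,n,\gamma,\rho$ and a monic polynomial $E\in\mathbb{Z}[X]$ of degree $n$ such that $0<\gamma<p$, $E(\gamma)\equiv 0 \pmod p$, and for every integer $x\in\{0,\dots,p-1\}$ there exist integers $x_0,\dots,x_{n-1}$ with $-\rho<x_i<\rho$ for all $i$ and $x\equiv \sum_{i=0}^{n-1}x_i\gamma^i \pmod p$. Vectors $(v_0,\dots,v_{n-1})$ are identified with polynomials $\sum v_iX^i$; $\mathfrak{L}$ is the set of integer polynomials of degree $<n$ vanishing at $\gamma$ modulo $p$. *)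

theory Defs
  imports
    "Jordan_Normal_Form.VS_Connect"
    "HOL-Analysis.L2_Norm"
    "HOL-Number_Theory.Cong"
begin

definition PMNS :: "int \<Rightarrow> nat \<Rightarrow> int \<Rightarrow> int \<Rightarrow> int poly \<Rightarrow> bool" where
  "PMNS p n \<gamma> \<rho> E \<longleftrightarrow>
     lead_coeff E = 1 \<and> degree E = n \<and>
     0 < \<gamma> \<and> \<gamma> < p \<and> [poly E \<gamma> = 0] (mod p) \<and>
     (\<forall>x\<in>{0..p - 1}. \<exists>xs :: nat \<Rightarrow> int.
        (\<forall>i<n. - \<rho> < xs i \<and> xs i < \<rho>) \<and>
        [x = (\<Sum>i<n. xs i * \<gamma> ^ i)] (mod p))"

definition pmns_row :: "int \<Rightarrow> nat \<Rightarrow> int \<Rightarrow> nat \<Rightarrow> int vec" where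
  "pmns_row p n \<gamma> i =
     (if i = 0 then p \<cdot>\<^sub>v unit_vec n 0
      else (- \<gamma>) \<cdot>\<^sub>v unit_vec n (i - 1) + unit_vec n i)"

definition pmns_lattice :: "int \<Rightarrow> nat \<Rightarrow> int \<Rightarrow> int vec set" where
  "pmns_lattice p n \<gamma> = vec_module.lattice_of n (map (pmns_row p n \<gamma>) [0..<n])"

definition euclidean_norm :: "real vec \<Rightarrow> real" where
  "euclidean_norm v = L2_set (\<lambda>i. v $ i) {..<dim_vec v}"

definition covers_within :: "nat \<Rightarrow> int vec set \<Rightarrow> real \<Rightarrow> bool" where
  "covers_within n L r \<longleftrightarrow>
     (\<forall>T\<in>carrier_vec n. \<exists>V\<in>L. euclidean_norm (T - map_vec real_of_int V) \<le> r)"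

definition covering_radius :: "nat \<Rightarrow> int vec set \<Rightarrow> real" where
  "covering_radius n L = (LEAST r. 0 \<le> r \<and> covers_within n L r)"


text \<open>
  On the reals a \<open>LEAST\<close> need not exist; the following facts show that it does here, so that
  \<open>covering_radius\<close> is an attained minimum.
\<close>

lemma coord_le_euclidean_norm:
  assumes "i < dim_vec v"
  shows "\<bar>v $ i\<bar> \<le> euclidean_norm v"
proof -
  have "\<bar>v $ i\<bar> \<le> L2_set (\<lambda>i. \<bar>v $ i\<bar>) {..<dim_vec v}"
    using assms by (intro member_le_L2_set[where f = "\<lambda>i. \<bar>v $ i\<bar>"]) auto
  then show ?thesis
    by (simp add: euclidean_norm_def L2_set_def)
qed

lemma finite_int_vec_near:
  assumes T: "T \<in> carrier_vec n"
  shows "finite {V \<in> carrier_vec n. euclidean_norm (T - map_vec real_of_int V) \<le> s}"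
proof -
  obtain B where B: "\<And>i. i < n \<Longrightarrow> \<bar>T $ i\<bar> \<le> B"
  proof
    fix i assume "i < n"
    then show "\<bar>T $ i\<bar> \<le> (\<Sum>i<n. \<bar>T $ i\<bar>)"
      by (intro member_le_sum) auto
  qed
  define K where "K = \<lceil>B + s\<rceil>"
  have "{V \<in> carrier_vec n. euclidean_norm (T - map_vec real_of_int V) \<le> s}
        \<subseteq> vec_of_list ` {xs. set xs \<subseteq> {- K..K} \<and> length xs = n}"
  proof
    fix V assume V: "V \<in> {V \<in> carrier_vec n. euclidean_norm (T - map_vec real_of_int V) \<le> s}"
    have "V $ i \<in> {- K..K}" if i: "i < n" for i
    proof -
      have "\<bar>(T - map_vec real_of_int V) $ i\<bar> \<le> s"
        using coord_le_euclidean_norm[of i "T - map_vec real_of_int V"] V i by auto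
      then have "\<bar>T $ i - real_of_int (V $ i)\<bar> \<le> s" using V i by auto
      then have "\<bar>real_of_int (V $ i)\<bar> \<le> B + s" using B[OF i] by linarith
      then have "\<bar>V $ i\<bar> \<le> K" unfolding K_def by linarith
      then show ?thesis by auto
    qed
    then have "set (list_of_vec V) \<subseteq> {- K..K}" "length (list_of_vec V) = n"
      using V by (auto simp: set_list_of_vec vec_set_def)
    then show "V \<in> vec_of_list ` {xs. set xs \<subseteq> {- K..K} \<and> length xs = n}"
      by (metis (mono_tags, lifting) image_eqI mem_Collect_eq vec_list)
  qed
  moreover have "finite {xs. set xs \<subseteq> {- K..K} \<and> length xs = n}"
    by (rule finite_lists_length_eq) simp
  ultimately show ?thesis using finite_surj by blast
qed

lemma covering_radius_attained:
  assumes L: "L \<subseteq> carrier_vec n" and s: "0 \<le> s" "covers_within n L s"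
  shows "0 \<le> covering_radius n L" and "covers_within n L (covering_radius n L)"
    and "\<And>r. 0 \<le> r \<Longrightarrow> covers_within n L r \<Longrightarrow> covering_radius n L \<le> r"
proof -
  define S where "S = {r. 0 \<le> r \<and> covers_within n L r}"
  have sS: "s \<in> S" using s by (simp add: S_def)
  have bdd: "bdd_below S" unfolding S_def by (rule bdd_belowI[of _ 0]) auto
  have nn: "0 \<le> Inf S" using sS by (intro cInf_greatest) (auto simp: S_def)
  have cov: "covers_within n L (Inf S)"
    unfolding covers_within_def
  proof
    fix T :: "real vec" assume T: "T \<in> carrier_vec n"
    let ?d = "\<lambda>V. euclidean_norm (T - map_vec real_of_int V)"
    define F where "F = {V \<in> L. ?d V \<le> s}"
    have fin: "finite F"
      by (rule finite_subset[OF _ finite_int_vec_near[OF T, of s]]) (use L in \<open>auto simp: F_def\<close>)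
    have ne: "F \<noteq> {}" using s T by (auto simp: F_def covers_within_def)
    obtain V where V: "V \<in> F" "\<And>W. W \<in> F \<Longrightarrow> ?d V \<le> ?d W"
      using ex_min_if_finite[of "?d ` F"] fin ne
      by (metis (no_types, lifting) arg_min_if_finite(1) arg_min_least)
    have "?d V \<le> r" if r: "r \<in> S" for r
    proof -
      obtain W where "W \<in> L" "?d W \<le> r" using r T by (auto simp: S_def covers_within_def)
      then show ?thesis using V by (cases "W \<in> F") (fastforce simp: F_def)+
    qed
    then have "?d V \<le> Inf S" using sS by (intro cInf_greatest) auto
    then show "\<exists>V\<in>L. ?d V \<le> Inf S" using V by (auto simp: F_def)
  qed
  have least: "Inf S \<le> r" if "0 \<le> r" "covers_within n L r" for r
    using that bdd by (intro cInf_lower) (auto simp: S_def)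
  have eq: "covering_radius n L = Inf S"
    unfolding covering_radius_def using nn cov least by (intro Least_equality) auto
  show "0 \<le> covering_radius n L" "covers_within n L (covering_radius n L)"
    using nn cov by (simp_all add: eq)
  show "\<And>r. 0 \<le> r \<Longrightarrow> covers_within n L r \<Longrightarrow> covering_radius n L \<le> r"
    using least by (simp add: eq)
qed

lemma pmns_row_carrier [simp]: "pmns_row p n \<gamma> i \<in> carrier_vec n"
  by (simp add: pmns_row_def)

lemma pmns_row_index:
  assumes "i < n" "j < n"
  shows "pmns_row p n \<gamma> i $ j =
    (if i = 0 then (if j = 0 then p else 0)
     else (if j = i then 1 else 0) - (if i = Suc j then \<gamma> else 0))"
  using assms by (auto simp: pmns_row_def unit_vec_def)

lemma pmns_lattice_carrier: "pmns_lattice p n \<gamma> \<subseteq> carrier_vec n"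
proof
  interpret vec_module "TYPE(int)" n .
  fix V assume "V \<in> pmns_lattice p n \<gamma>"
  then obtain c where "V = sumlist (map (\<lambda>i. of_int (c i) \<cdot>\<^sub>v map (pmns_row p n \<gamma>) [0..<n] ! i)
      [0..<length (map (pmns_row p n \<gamma>) [0..<n])])"
    unfolding pmns_lattice_def by (rule in_latticeE)
  then show "V \<in> carrier_vec n" by (auto intro!: sumlist_carrier)
qed

lemma pmns_latticeI:
  fixes c :: "nat \<Rightarrow> int"
  shows "vec n (\<lambda>j. \<Sum>i<n. c i * pmns_row p n \<gamma> i $ j) \<in> pmns_lattice p n \<gamma>"
proof -
  interpret vec_module "TYPE(int)" n .
  let ?W = "sumlist (map (\<lambda>i. of_int (c i) \<cdot>\<^sub>v map (pmns_row p n \<gamma>) [0..<n] ! i)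
      [0..<length (map (pmns_row p n \<gamma>) [0..<n])])"
  have W: "?W \<in> carrier_vec n" by (auto intro!: sumlist_carrier)
  have "vec n (\<lambda>j. \<Sum>i<n. c i * pmns_row p n \<gamma> i $ j) = ?W"
  proof (rule eq_vecI)
    fix j assume "j < dim_vec ?W"
    then have j: "j < n" using W by auto
    have "?W $ j = (\<Sum>i = 0..<n. c i * pmns_row p n \<gamma> i $ j)"
      using j by (subst sumlist_nth) (auto simp: carrier_vecD[OF pmns_row_carrier])
    then show "vec n (\<lambda>j. \<Sum>i<n. c i * pmns_row p n \<gamma> i $ j) $ j = ?W $ j"
      using j by (simp add: atLeast0LessThan)
  qed (use W in auto)
  then show ?thesis unfolding pmns_lattice_def by (intro in_latticeI)
qed

lemma pmns_lattice_covers: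
  assumes p: "0 < p" and n: "0 < n"
  shows "covers_within n (pmns_lattice p n \<gamma>) (real n * real_of_int p)"
  unfolding covers_within_def
proof
  fix T :: "real vec" assume T: "T \<in> carrier_vec n"
  define f where "f = rec_nat 0 (\<lambda>d a. \<lfloor>T $ (n - Suc d)\<rfloor> + \<gamma> * a)"
  have f_Suc: "f (Suc d) = \<lfloor>T $ (n - Suc d)\<rfloor> + \<gamma> * f d" and f0: "f 0 = 0" for d
    by (simp_all add: f_def)
  define g where "g i = f (n - i)" for i
  have g: "g i = \<lfloor>T $ i\<rfloor> + \<gamma> * g (Suc i)" if "i < n" for i
    using that f_Suc[of "n - Suc i"] by (simp add: g_def Suc_diff_Suc)
  have gn: "g n = 0" by (simp add: g_def f0)
  define c where "c i = (if i = 0 then (\<lfloor>T $ 0\<rfloor> + \<gamma> * g 1) div p else g i)" for i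
  define V where "V = vec n (\<lambda>j. \<Sum>i<n. c i * pmns_row p n \<gamma> i $ j)"
  have V_nth: "V $ j = (if j = 0 then p * c 0 else c j) - \<gamma> * g (Suc j)" if j: "j < n" for j
  proof -
    have "V $ j = (\<Sum>i<n. c i * (if i = 0 then (if j = 0 then p else 0)
        else (if j = i then 1 else 0) - (if i = Suc j then \<gamma> else 0)))"
      using j by (auto simp: V_def pmns_row_index intro!: sum.cong)
    also have "\<dots> = (\<Sum>i<n. (if i = j then c i * (if j = 0 then p else 1) else 0)
        - (if i = Suc j then c i * \<gamma> else 0))"
      by (intro sum.cong) auto
    also have "\<dots> = c j * (if j = 0 then p else 1) - (if Suc j < n then c (Suc j) * \<gamma> else 0)"
      using j by (simp add: sum_subtractf)
    also have "(if Suc j < n then c (Suc j) * \<gamma> else 0) = \<gamma> * g (Suc j)"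
    proof (cases "Suc j < n")
      case True
      then show ?thesis by (simp add: c_def)
    next
      case False
      then have "Suc j = n" using j by simp
      then show ?thesis using gn by simp
    qed
    finally show ?thesis by auto
  qed
  have close: "\<bar>T $ j - real_of_int (V $ j)\<bar> \<le> real_of_int p" if j: "j < n" for j
  proof (cases "j = 0")
    case True
    let ?a = "\<lfloor>T $ 0\<rfloor> + \<gamma> * g 1"
    have "V $ 0 = \<lfloor>T $ 0\<rfloor> - ?a mod p"
      using V_nth[of 0] n by (simp add: c_def minus_mod_eq_mult_div [symmetric])
    then have "T $ 0 - real_of_int (V $ 0) = (T $ 0 - \<lfloor>T $ 0\<rfloor>) + real_of_int (?a mod p)"
      by simp
    moreover have "0 \<le> real_of_int (?a mod p)" using p by simp
    moreover have "real_of_int (?a mod p) \<le> real_of_int p - 1"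
      using pos_mod_bound[OF p, of ?a] by linarith
    moreover have "0 \<le> T $ 0 - \<lfloor>T $ 0\<rfloor>" "T $ 0 - \<lfloor>T $ 0\<rfloor> \<le> 1" by linarith+
    ultimately have "\<bar>T $ 0 - real_of_int (V $ 0)\<bar> \<le> real_of_int p" by linarith
    then show ?thesis using True by simp
  next
    case False
    then have "V $ j = \<lfloor>T $ j\<rfloor>" using V_nth[OF j] g[OF j] by (simp add: c_def)
    then show ?thesis using p by linarith
  qed
  have "euclidean_norm (T - map_vec real_of_int V)
        \<le> (\<Sum>j<n. \<bar>(T - map_vec real_of_int V) $ j\<bar>)"
    using L2_set_le_sum_abs[of "\<lambda>i. (T - map_vec real_of_int V) $ i" "{..<n}"]
    by (simp add: euclidean_norm_def V_def)
  also have "\<dots> \<le> (\<Sum>j<n. real_of_int p)"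
    using close T by (intro sum_mono) (auto simp: V_def)
  finally have "euclidean_norm (T - map_vec real_of_int V) \<le> real n * real_of_int p" by simp
  moreover have "V \<in> pmns_lattice p n \<gamma>" unfolding V_def by (rule pmns_latticeI)
  ultimately show "\<exists>V\<in>pmns_lattice p n \<gamma>.
      euclidean_norm (T - map_vec real_of_int V) \<le> real n * real_of_int p" by blast
qed

lemma pmns_covering_radius_attained:
  assumes "0 < p" "0 < n"
  shows "0 \<le> covering_radius n (pmns_lattice p n \<gamma>)"
    and "covers_within n (pmns_lattice p n \<gamma>) (covering_radius n (pmns_lattice p n \<gamma>))"
    and "\<And>r. 0 \<le> r \<Longrightarrow> covers_within n (pmns_lattice p n \<gamma>) r
           \<Longrightarrow> covering_radius n (pmns_lattice p n \<gamma>) \<le> r"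
  using covering_radius_attained[OF pmns_lattice_carrier _ pmns_lattice_covers[OF assms, of \<gamma>]] assms
  by simp_all

end

theory Submission
  imports Defs
begin

text \<open>
  Every vector of the lattice, read as a polynomial, vanishes at \<open>\<gamma>\<close> modulo \<open>p\<close>. Subtracting from
  \<open>(x, 0, \<dots>, 0)\<close> a lattice vector within distance \<open>r\<close> therefore does not change the residue that is
  represented, and each coordinate of the difference is bounded by its norm, hence by \<open>r < \<rho>\<close>.
\<close>

text \<open>Row 0 evaluates to \<open>p\<close> itself. Row \<open>Suc k\<close> is the polynomial
  X^(k+1) - \<gamma> X^k, which has \<gamma> as a root already over the integers.\<close>

lemma pmns_row_eval_dvd:
  assumes i: "i < n"
  shows "p dvd (\<Sum>j<n. pmns_row p n \<gamma> i $ j * \<gamma> ^ j)"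
proof (cases i)
  case 0
  have "(\<Sum>j<n. pmns_row p n \<gamma> i $ j * \<gamma> ^ j) = (\<Sum>j<n. if j = 0 then p else 0)"
    using 0 i by (intro sum.cong) (auto simp: pmns_row_index)
  then show ?thesis using 0 i by simp
next
  case (Suc k)
  have "(\<Sum>j<n. pmns_row p n \<gamma> i $ j * \<gamma> ^ j)
      = (\<Sum>j<n. (if j = Suc k then \<gamma> ^ j else 0) - (if j = k then \<gamma> * \<gamma> ^ j else 0))"
    using Suc i by (intro sum.cong) (auto simp: pmns_row_index)
  also have "\<dots> = 0" using Suc i by (simp add: sum_subtractf)
  finally show ?thesis by simp
qed

text \<open>Counterpart of \<open>pmns_latticeI\<close>: it turns the \<open>sumlist\<close> form of
  membership into coordinates, so that evaluation at \<gamma> reduces to finite double sums.\<close>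

lemma pmns_latticeE:
  assumes "V \<in> pmns_lattice p n \<gamma>"
  obtains c :: "nat \<Rightarrow> int"
  where "\<And>j. j < n \<Longrightarrow> V $ j = (\<Sum>i<n. c i * pmns_row p n \<gamma> i $ j)"
proof -
  interpret vec_module "TYPE(int)" n .
  obtain c where V: "V = sumlist (map (\<lambda>i. of_int (c i) \<cdot>\<^sub>v map (pmns_row p n \<gamma>) [0..<n] ! i)
      [0..<length (map (pmns_row p n \<gamma>) [0..<n])])"
    using assms unfolding pmns_lattice_def by (rule in_latticeE)
  have "V $ j = (\<Sum>i<n. c i * pmns_row p n \<gamma> i $ j)" if "j < n" for j
    unfolding V using that
    by (subst sumlist_nth) (auto simp: carrier_vecD[OF pmns_row_carrier] atLeast0LessThan)
  then show thesis by (rule that)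
qed

text \<open>Evaluation at \<gamma> is linear, so exchanging the sums reduces the claim to the
  generating rows.\<close>

lemma pmns_lattice_eval_dvd:
  assumes "V \<in> pmns_lattice p n \<gamma>"
  shows "p dvd (\<Sum>j<n. V $ j * \<gamma> ^ j)"
proof -
  obtain c where V: "\<And>j. j < n \<Longrightarrow> V $ j = (\<Sum>i<n. c i * pmns_row p n \<gamma> i $ j)"
    using pmns_latticeE[OF assms] by metis
  have "(\<Sum>j<n. V $ j * \<gamma> ^ j) = (\<Sum>j<n. \<Sum>i<n. c i * (pmns_row p n \<gamma> i $ j * \<gamma> ^ j))"
    by (simp add: V sum_distrib_right mult.assoc)
  also have "\<dots> = (\<Sum>i<n. c i * (\<Sum>j<n. pmns_row p n \<gamma> i $ j * \<gamma> ^ j))"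
    by (subst sum.swap) (simp add: sum_distrib_left)
  finally show ?thesis
    by (auto intro!: dvd_sum dvd_mult pmns_row_eval_dvd)
qed

lemma covers_within_ex_small_representative:
  assumes n: "0 < n" and cov: "covers_within n (pmns_lattice p n \<gamma>) r"
    and r: "r < real_of_int \<rho>"
  shows "\<exists>xs :: nat \<Rightarrow> int. (\<forall>i<n. - \<rho> < xs i \<and> xs i < \<rho>) \<and>
    [x = (\<Sum>i<n. xs i * \<gamma> ^ i)] (mod p)"
proof -
  \<comment> \<open>The constant polynomial \<open>x\<close>, as a point of real space to be
    approximated.\<close>
  define T :: "real vec" where "T = vec n (\<lambda>i. if i = 0 then real_of_int x else 0)"
  have "T \<in> carrier_vec n" by (simp add: T_def)
  then obtain V where V: "V \<in> pmns_lattice p n \<gamma>"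
    and d: "euclidean_norm (T - map_vec real_of_int V) \<le> r"
    using cov by (auto simp: covers_within_def)
  have dim: "dim_vec V = n" using V pmns_lattice_carrier[of p n \<gamma>] by auto
  \<comment> \<open>\<open>T - V\<close> computed over the integers, which is possible because
    \<open>T\<close> has integral entries.\<close>
  define xs where "xs i = (if i = 0 then x else 0) - V $ i" for i
  have "- \<rho> < xs i \<and> xs i < \<rho>" if i: "i < n" for i
  proof -
    have "(T - map_vec real_of_int V) $ i = real_of_int (xs i)"
      using i dim by (simp add: T_def xs_def)
    then have "\<bar>real_of_int (xs i)\<bar> < real_of_int \<rho>"
      using coord_le_euclidean_norm[of i "T - map_vec real_of_int V"] i dim d r by simp
    then show ?thesis by linarith
  qed
  moreover have "[x = (\<Sum>i<n. xs i * \<gamma> ^ i)] (mod p)"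
  proof -
    have "(\<Sum>i<n. xs i * \<gamma> ^ i) = (\<Sum>i<n. (if i = 0 then x else 0) - V $ i * \<gamma> ^ i)"
      by (intro sum.cong) (auto simp: xs_def left_diff_distrib)
    \<comment> \<open>As \<open>0 < n\<close>, index 0 lies in the range and contributes
      \<open>x\<close>.\<close>
    also have "\<dots> = x - (\<Sum>i<n. V $ i * \<gamma> ^ i)"
      using n by (simp add: sum_subtractf)
    finally show ?thesis
      using pmns_lattice_eval_dvd[OF V] by (simp add: cong_iff_dvd_diff)
  qed
  ultimately show ?thesis by blast
qed

theorem theorem1:
  fixes p \<gamma> \<rho> :: int and n :: nat and E :: "int poly"
  assumes "p \<ge> 2" and "n \<ge> 2"
    and "lead_coeff E = 1" and "degree E = n"
    and "0 < \<gamma>" and "\<gamma> < p" and "[poly E \<gamma> = 0] (mod p)"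
    and "real_of_int \<rho> > covering_radius n (pmns_lattice p n \<gamma>)"
  shows "PMNS p n \<gamma> \<rho> E"
proof -
  \<comment> \<open>A \<open>LEAST\<close> over the reals has this property only because the minimum
    is attained.\<close>
  have "covers_within n (pmns_lattice p n \<gamma>) (covering_radius n (pmns_lattice p n \<gamma>))"
    using assms by (intro pmns_covering_radius_attained) auto
  then show ?thesis
    unfolding PMNS_def using assms covers_within_ex_small_representative[of n p \<gamma> _ \<rho>] by auto
qed

end
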